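(* Let $\mathbb{W}$ be an $m$-dimensional subspace of $\ell_\infty$ and let $\mathcal{A}=\{\widetilde{a_1},\ldots,\widetilde{a_m}\}$ be a basis of $\mathbb{W}$. Suppose that $\mathbb{P}$ is the set of all nonequivalent components of $\mathcal{A}$ satisfying the weak $*$-Property and $\mathbb{Q}$ is the set of all nonequivalent components of $\mathcal{A}$ satisfying the $*$-Property. Let $|\mathbb{P}|=|\mathbb{Q}|=r$ (with $r\in\mathbb{N}$). Then: (i) the number of facets of $B_{\mathbb{W}}$ is $2r$; (ii) for $n\in\mathbb{N}$, $\mathbb{W}$ can be (linearly isometrically) embedded into $\ell_\infty^n$ if and only if $r\le n$; (iii) $\mathbb{W}$ is isometrically isomorphic to $\ell_\infty^m$ if and only if $r=m$.
   Context: All spaces are over $\mathbb{R}$; $\ell_\infty$ is the space of bounded real sequences with the supremum norm, $\ell_\infty^n$ is $\mathbb{R}^n$ with the maximum norm, and $B_{\mathbb{X}}$ is the closed unit ball of $\mathbb{X}$. Components. Let $\mathcal{A}=\{\widetilde{a_1},\ldots,\widetilde{a_m}\}\subset\ell_\infty$ be linearly independent, $\widetilde{a_k}=(a_1^k,a_2^k,\ldots)$. Put $\mathcal{S}=\{(a_i^1,a_i^2,\ldots,a_i^m)\in\mathbb{R}^m: i\in\mathbb{N}\}$ and let $\overline{\mathcal{S}}$ be its closure in the Euclidean topology of $\mathbb{R}^m$. Elements of $\overline{\mathcal{S}}$ are called components of $\mathcal{A}$. Two components $\mathbf{a},\mathbf{b}\in\overline{\mathcal{S}}$ are equivalent if $\mathbf{a}=\pm\mathbf{b}$,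 and $E_{\mathbf{a}}=\{\mathbf{b}\in\overline{\mathcal{S}}:\mathbf{b}=\pm\mathbf{a}\}$. A component $\mathbf{a}=(\widehat{a}_1,\ldots,\widehat{a}_m)\in\overline{\mathcal{S}}$ satisfies the $*$-Property if there is $(\beta_1,\ldots,\beta_m)\in\mathbb{R}^m$ such that $|\sum_{k=1}^m\beta_k\widehat{a}_k|>|\sum_{k=1}^m\beta_k\widehat{b}_k|$ for all $\mathbf{b}=(\widehat{b}_1,\ldots,\widehat{b}_m)\in\overline{\mathcal{S}}\setminus E_{\mathbf{a}}$. It satisfies the weak $*$-Property if there is a nonzero $(\beta_1,\ldots,\beta_m)\in\mathbb{R}^m$ such that $|\sum_{k=1}^m\beta_k\widehat{a}_k|\ge\sup\{|\sum_{k=1}^m\beta_k\widehat{b}_k|:\mathbf{b}\in\overline{\mathcal{S}}\setminus E_{\mathbf{a}}\}$ (with $\sup\emptyset=0$). "The set of all nonequivalent components satisfying a property" means a set containing exactly one representative of each equivalence class of components satisfying the property. Facets. For a finite-dimensional Banach space $\mathbb{X}$, a proper face of $B_{\mathbb{X}}$ is a non-empty set of the form $B_{\mathbb{X}}\cap\delta M$, where $M$ is a closed half-space containing $B_{\mathbb{X}}$ and $\delta M$ is its boundary; $B_{\mathbb{X}}$ itself is also called a face. A facet of $B_{\mathbb{X}}$ is a proper face that is maximal under inclusion among proper faces. *)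

theory Defs
  imports "HOL-Analysis.Analysis"
begin

(* Every function on the discrete space nat is continuous, so the bounded continuous functions
   from nat to real, with their library norm, are the bounded real sequences with the sup norm. *)
type_synonym linf = "nat \<Rightarrow>\<^sub>C real"

definition component_set :: "('m::finite \<Rightarrow> linf) \<Rightarrow> (real^'m) set" where
  "component_set a = closure (range (\<lambda>i. \<chi> k. apply_bcontfun (a k) i))"

definition equiv_components :: "('m::finite \<Rightarrow> linf) \<Rightarrow> real^'m \<Rightarrow> (real^'m) set" where
  "equiv_components a p = {q \<in> component_set a. q = p \<or> q = - p}"

definition star_property :: "('m::finite \<Rightarrow> linf) \<Rightarrow> real^'m \<Rightarrow> bool" where
  "star_property a p \<longleftrightarrow> p \<in> component_set a \<and>
     (\<exists>\<beta>::real^'m. \<forall>q \<in> component_set a - equiv_components a p.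
        \<bar>\<Sum>k\<in>UNIV. \<beta> $ k * p $ k\<bar> > \<bar>\<Sum>k\<in>UNIV. \<beta> $ k * q $ k\<bar>)"

(* The case distinction is the convention that the supremum of the empty set is 0; the library
   leaves Sup of the empty set of reals unspecified. *)
definition weak_star_property :: "('m::finite \<Rightarrow> linf) \<Rightarrow> real^'m \<Rightarrow> bool" where
  "weak_star_property a p \<longleftrightarrow> p \<in> component_set a \<and>
     (\<exists>\<beta>::real^'m. \<beta> \<noteq> 0 \<and>
        \<bar>\<Sum>k\<in>UNIV. \<beta> $ k * p $ k\<bar> \<ge>
          (if component_set a - equiv_components a p = {} then 0
           else (SUP q \<in> component_set a - equiv_components a p. \<bar>\<Sum>k\<in>UNIV. \<beta> $ k * q $ k\<bar>)))"

definition nonequiv_representatives ::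
    "('m::finite \<Rightarrow> linf) \<Rightarrow> (real^'m \<Rightarrow> bool) \<Rightarrow> (real^'m) set \<Rightarrow> bool" where
  "nonequiv_representatives a \<Phi> P \<longleftrightarrow>
     P \<subseteq> {p \<in> component_set a. \<Phi> p} \<and>
     (\<forall>p \<in> component_set a. \<Phi> p \<longrightarrow> (\<exists>!q. q \<in> P \<and> q \<in> equiv_components a p))"

definition linear_on_subspace :: "'a::real_vector set \<Rightarrow> ('a \<Rightarrow> 'b::real_vector) \<Rightarrow> bool" where
  "linear_on_subspace W T \<longleftrightarrow>
     (\<forall>x\<in>W. \<forall>y\<in>W. T (x + y) = T x + T y) \<and> (\<forall>c. \<forall>x\<in>W. T (c *\<^sub>R x) = c *\<^sub>R T x)"

definition unit_ball_of :: "'a::real_normed_vector set \<Rightarrow> 'a set" where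
  "unit_ball_of W = {x \<in> W. norm x \<le> 1}"

(* For a finite-dimensional subspace W, regarded as a normed space of its own. The closed
   half-spaces of W are the sets {x in W. f x <= c} with f a linear functional that is nonzero
   on W (f is automatically continuous there); the boundary of such a set is {x in W. f x = c}. *)
definition proper_face_of_ball :: "'a::real_normed_vector set \<Rightarrow> 'a set \<Rightarrow> bool" where
  "proper_face_of_ball W F \<longleftrightarrow> F \<noteq> {} \<and>
     (\<exists>(f::'a \<Rightarrow> real) c. linear_on_subspace W f \<and> (\<exists>x\<in>W. f x \<noteq> 0) \<and>
        unit_ball_of W \<subseteq> {x \<in> W. f x \<le> c} \<and>
        F = unit_ball_of W \<inter> {x \<in> W. f x = c})"

definition facet_of_ball :: "'a::real_normed_vector set \<Rightarrow> 'a set \<Rightarrow> bool" where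
  "facet_of_ball W F \<longleftrightarrow> proper_face_of_ball W F \<and>
     (\<forall>G. proper_face_of_ball W G \<and> F \<subseteq> G \<longrightarrow> G = F)"

(* The n-dimensional space with the maximum norm is the type real^'n, CARD('n) = n, normed by
   infnorm, the maximum of the absolute values of the coordinates; the library norm on real^'n
   is the Euclidean one and is not used here. *)
definition isometric_embedding_linf ::
    "'a::real_normed_vector set \<Rightarrow> ('a \<Rightarrow> real^'n::finite) \<Rightarrow> bool" where
  "isometric_embedding_linf W T \<longleftrightarrow>
     linear_on_subspace W T \<and> (\<forall>x\<in>W. infnorm (T x) = norm x)"

definition isometric_isomorphism_linf ::
    "'a::real_normed_vector set \<Rightarrow> ('a \<Rightarrow> real^'n::finite) \<Rightarrow> bool" where
  "isometric_isomorphism_linf W T \<longleftrightarrow> isometric_embedding_linf W T \<and> bij_betw T W UNIV"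

end

theory Submission
  imports Defs
begin

text \<open>
  Identify \<open>W\<close> with \<open>\<real>\<^sup>m\<close> through the basis \<open>a\<close>. A combination
  \<open>\<Sum>k. \<beta>\<^sub>k a\<^sub>k\<close> takes at the index \<open>i\<close> the value \<open>\<beta> \<bullet> q\<close>, where \<open>q\<close> is the \<open>i\<close>-th component,
  so its norm is the maximum of \<open>\<bar>\<beta> \<bullet> q\<bar>\<close> over the compact set of components. Thus the components
  are functionals that norm \<open>W\<close>. A component has the weak star property exactly if it attains the
  norm somewhere off the origin, and the star property exactly if it is, up to sign, the only one to
  do so at some vector. Since a star component is also a weak star component, equality of the two
  cardinalities makes the two properties agree. Hence the \<open>r\<close> members of \<open>P\<close> norm \<open>W\<close>, and none of
  them is redundant: each one strictly dominates the others at some vector.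

  The rest is about a normed space whose norm is \<open>max\<^sub>i \<bar>g\<^sub>i x\<bar>\<close> for finitely many functionals
  \<open>g\<^sub>i\<close>. By averaging, every proper face of the ball lies in one of the slices \<open>g\<^sub>i = \<plusminus>1\<close>
  (\<open>proper_face_in_unit_slice\<close>). If no functional is redundant, these slices are therefore the
  facets, and they are distinct (\<open>facets_irredundant\<close>), which gives the count \<open>2 r\<close>. In general there
  are at most twice as many facets as functionals (\<open>card_facets_le\<close>). An isometric embedding into
  \<open>\<real>\<^sup>n\<close> with the maximum norm is the same thing as a norming family with \<open>n\<close> members, its
  coordinates; so it forces \<open>2 r \<le> 2 n\<close>, and for \<open>r \<le> n\<close> it is obtained by listing \<open>P\<close> with
  repetitions. Finally \<open>P\<close> spans \<open>\<real>\<^sup>m\<close>, because a vector orthogonal to \<open>P\<close> has norm zero. So always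
  \<open>m \<le> r\<close>, while an embedding between spaces of equal finite dimension is onto.
\<close>

section \<open>Faces of a ball normed by finitely many functionals\<close>

definition norming_family ::
    "'a::real_normed_vector set \<Rightarrow> 'i set \<Rightarrow> ('i \<Rightarrow> 'a \<Rightarrow> real) \<Rightarrow> bool" where
  "norming_family W I g \<longleftrightarrow> finite I \<and> (\<forall>i\<in>I. linear_on_subspace W (g i)) \<and>
     (\<forall>x\<in>W. (\<forall>i\<in>I. \<bar>g i x\<bar> \<le> norm x) \<and> (\<exists>i\<in>I. \<bar>g i x\<bar> = norm x))"

definition unit_slice :: "'a::real_normed_vector set \<Rightarrow> ('a \<Rightarrow> real) \<Rightarrow> real \<Rightarrow> 'a set" where
  "unit_slice W h s = {x \<in> unit_ball_of W. h x = s}"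

lemma linear_on_subspace_add:
  "linear_on_subspace W f \<Longrightarrow> x \<in> W \<Longrightarrow> y \<in> W \<Longrightarrow> f (x + y) = f x + f y"
  by (simp add: linear_on_subspace_def)

lemma linear_on_subspace_scale:
  "linear_on_subspace W f \<Longrightarrow> x \<in> W \<Longrightarrow> f (c *\<^sub>R x) = c *\<^sub>R f x"
  by (simp add: linear_on_subspace_def)

lemma linear_on_subspace_sum:
  assumes "subspace W" "linear_on_subspace W f" "finite A" "\<And>j. j \<in> A \<Longrightarrow> y j \<in> W"
  shows "f (\<Sum>j\<in>A. y j) = (\<Sum>j\<in>A. f (y j))"
  using assms(3,4)
proof (induction A rule: finite_induct)
  case empty
  have "f (0 *\<^sub>R 0) = 0 *\<^sub>R f 0"
    using assms(1,2) by (intro linear_on_subspace_scale) (auto simp: subspace_0)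
  then show ?case by simp
next
  case (insert j A)
  then have "f (y j + (\<Sum>j\<in>A. y j)) = f (y j) + f (\<Sum>j\<in>A. y j)"
    using assms(1,2) by (intro linear_on_subspace_add) (auto intro: subspace_sum)
  with insert show ?case by simp
qed

text \<open>A point in the interior of the ball can be pushed outward along its own ray, which would
  raise a functional beyond its maximum on the ball.\<close>

lemma proper_face_norm_eq_1:
  fixes W :: "'a::real_normed_vector set"
  assumes W: "subspace W" and F: "proper_face_of_ball W F" and x: "x \<in> F"
  shows "norm x = 1"
proof (rule ccontr)
  assume n: "norm x \<noteq> 1"
  from F obtain f :: "'a \<Rightarrow> real" and c where f: "linear_on_subspace W f" and ne: "\<exists>x\<in>W. f x \<noteq> 0"
    and le: "unit_ball_of W \<subseteq> {x \<in> W. f x \<le> c}"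
    and eq: "F = unit_ball_of W \<inter> {x \<in> W. f x = c}"
    unfolding proper_face_of_ball_def by blast
  have bound: "f u \<le> c * norm u" if u: "u \<in> W" for u
  proof (cases "u = 0")
    case True
    then show ?thesis using linear_on_subspace_scale[OF f u, of 0] by simp
  next
    case False
    have "(1 / norm u) *\<^sub>R u \<in> unit_ball_of W"
      using u W False by (simp add: unit_ball_of_def subspace_scale)
    then have "f ((1 / norm u) *\<^sub>R u) \<le> c" using le by blast
    then show ?thesis
      using False linear_on_subspace_scale[OF f u, of "1 / norm u"]
      by (simp add: divide_simps)
  qed
  obtain z where z: "z \<in> W" "f z \<noteq> 0" using ne by blast
  have "f (-1 *\<^sub>R z) = - f z" using linear_on_subspace_scale[OF f z(1), of "-1"] by simp
  with bound[OF z(1)] bound[of "-1 *\<^sub>R z"] W z have "0 < c * norm z"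
    by (simp add: subspace_neg)
  then have c: "0 < c" by (simp add: zero_less_mult_iff)
  have xs: "x \<in> W" "norm x \<le> 1" "f x = c" using x eq by (auto simp: unit_ball_of_def)
  with n have "c * norm x < c" using c by simp
  with bound[OF xs(1)] xs(3) show False by simp
qed

lemma convex_proper_face:
  fixes W :: "'a::real_normed_vector set"
  assumes W: "subspace W" and F: "proper_face_of_ball W F"
  shows "convex F"
proof -
  from F obtain f :: "'a \<Rightarrow> real" and c where f: "linear_on_subspace W f"
    and eq: "F = unit_ball_of W \<inter> {x \<in> W. f x = c}"
    unfolding proper_face_of_ball_def by blast
  have "unit_ball_of W = W \<inter> cball 0 1" by (auto simp: unit_ball_of_def)
  then have "convex (unit_ball_of W)"
    using W by (simp add: convex_Int subspace_imp_convex)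
  moreover have "convex {x \<in> W. f x = c}"
  proof (rule convexI)
    fix x y and u v :: real
    assume x: "x \<in> {x \<in> W. f x = c}" and y: "y \<in> {x \<in> W. f x = c}" and uv: "u + v = 1"
    have "f (u *\<^sub>R x + v *\<^sub>R y) = (u + v) * c"
      using x y W by (simp add: linear_on_subspace_add[OF f] linear_on_subspace_scale[OF f]
          subspace_scale algebra_simps)
    with x y W uv show "u *\<^sub>R x + v *\<^sub>R y \<in> {x \<in> W. f x = c}"
      by (simp add: subspace_add subspace_scale)
  qed
  ultimately show ?thesis using eq by (simp add: convex_Int)
qed

text \<open>If the face left every slice, the average of one point outside each slice would be a point of
  the face at which all functionals are below \<open>1\<close> in modulus, hence a point of norm less than \<open>1\<close>.\<close>

lemma proper_face_in_unit_slice: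
  fixes W :: "'a::real_normed_vector set"
  assumes W: "subspace W" and g: "norming_family W I g" and F: "proper_face_of_ball W F"
  shows "\<exists>i\<in>I. \<exists>s\<in>{-1,1}. F \<subseteq> unit_slice W (g i) s"
proof (rule ccontr)
  assume neg: "\<not> ?thesis"
  define A where "A = I \<times> {-1, 1 :: real}"
  have FB: "F \<subseteq> unit_ball_of W" using F by (auto simp: proper_face_of_ball_def)
  have "\<forall>t\<in>A. \<exists>y\<in>F. g (fst t) y \<noteq> snd t"
    using neg FB by (fastforce simp: A_def unit_slice_def)
  then obtain y where y: "\<And>t. t \<in> A \<Longrightarrow> y t \<in> F \<and> g (fst t) (y t) \<noteq> snd t" by metis
  have finI: "finite I" using g by (simp add: norming_family_def)
  have "I \<noteq> {}" using g subspace_0[OF W] by (auto simp: norming_family_def)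
  then have A: "finite A" "A \<noteq> {}" using finI by (auto simp: A_def)
  then have cA: "real (card A) > 0" by (simp add: card_gt_0_iff)
  have yB: "y t \<in> W \<and> norm (y t) \<le> 1" if "t \<in> A" for t
    using y[OF that] FB by (auto simp: unit_ball_of_def)
  define x where "x = (\<Sum>t\<in>A. (1 / card A) *\<^sub>R y t)"
  have xF: "x \<in> F"
    unfolding x_def using A cA y
    by (intro convex_sum[OF A(1) convex_proper_face[OF W F]]) auto
  have xW: "x \<in> W" using xF FB by (auto simp: unit_ball_of_def)
  have nx: "norm x = 1" by (rule proper_face_norm_eq_1[OF W F xF])
  obtain i where i: "i \<in> I" "\<bar>g i x\<bar> = norm x" using g xW by (auto simp: norming_family_def)
  have gi: "linear_on_subspace W (g i)" using g i by (simp add: norming_family_def)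
  define s where "s = g i x"
  have s: "s \<in> {-1, 1}" using i nx by (auto simp: s_def)
  have sle: "s * g i (y t) \<le> 1" if "t \<in> A" for t
  proof -
    have "\<bar>g i (y t)\<bar> \<le> 1"
      using g i(1) yB[OF that] by (force simp: norming_family_def)
    then show ?thesis using s by auto
  qed
  have t0: "(i, s) \<in> A" using i s by (simp add: A_def)
  have slt: "s * g i (y (i, s)) < 1"
    using sle[OF t0] y[OF t0] s by auto
  have "g i x = (\<Sum>t\<in>A. g i ((1 / card A) *\<^sub>R y t))"
    unfolding x_def using W gi A yB by (intro linear_on_subspace_sum) (auto intro: subspace_scale)
  also have "\<dots> = (\<Sum>t\<in>A. g i (y t) / card A)"
    using yB by (intro sum.cong) (auto simp: linear_on_subspace_scale[OF gi])
  finally have "s * g i x = (\<Sum>t\<in>A. s * g i (y t)) / card A"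
    by (simp add: sum_distrib_left sum_divide_distrib)
  also have "\<dots> < (\<Sum>t\<in>A. 1) / card A"
  proof (rule divide_strict_right_mono[OF _ cA])
    show "(\<Sum>t\<in>A. s * g i (y t)) < (\<Sum>t\<in>A. 1)"
      using A sle slt t0 by (intro sum_strict_mono_ex1) auto
  qed
  finally have "s * s < 1" using cA by (simp add: s_def)
  then show False using s by auto
qed

lemma unit_slice_proper_face:
  fixes W :: "'a::real_normed_vector set"
  assumes W: "subspace W" and g: "norming_family W I g" and i: "i \<in> I" and s: "s \<in> {-1, 1}"
    and ne: "unit_slice W (g i) s \<noteq> {}"
  shows "proper_face_of_ball W (unit_slice W (g i) s)"
proof -
  have gi: "linear_on_subspace W (g i)" using g i by (simp add: norming_family_def)
  have "linear_on_subspace W (\<lambda>x. s * g i x)"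
    using gi by (simp add: linear_on_subspace_def algebra_simps)
  moreover have "\<exists>x\<in>W. s * g i x \<noteq> 0"
    using ne s unfolding unit_slice_def unit_ball_of_def by fastforce
  moreover have "unit_ball_of W \<subseteq> {x \<in> W. s * g i x \<le> 1}"
  proof
    fix x assume x: "x \<in> unit_ball_of W"
    then have "\<bar>g i x\<bar> \<le> 1" using g i by (force simp: norming_family_def unit_ball_of_def)
    then show "x \<in> {x \<in> W. s * g i x \<le> 1}" using x s by (auto simp: unit_ball_of_def)
  qed
  moreover have "unit_slice W (g i) s = unit_ball_of W \<inter> {x \<in> W. s * g i x = 1}"
    using s by (auto simp: unit_slice_def unit_ball_of_def)
  ultimately show ?thesis unfolding proper_face_of_ball_def
    using ne by (intro conjI exI[of _ "\<lambda>x. s * g i x"] exI[of _ 1]) auto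
qed

lemma facet_is_unit_slice:
  fixes W :: "'a::real_normed_vector set"
  assumes W: "subspace W" and g: "norming_family W I g" and F: "facet_of_ball W F"
  shows "\<exists>i\<in>I. \<exists>s\<in>{-1,1}. F = unit_slice W (g i) s"
proof -
  have pF: "proper_face_of_ball W F" using F by (simp add: facet_of_ball_def)
  then obtain i s where i: "i \<in> I" "s \<in> {-1,1}" "F \<subseteq> unit_slice W (g i) s"
    using proper_face_in_unit_slice[OF W g] by blast
  moreover have "F \<noteq> {}" using pF by (simp add: proper_face_of_ball_def)
  ultimately have "proper_face_of_ball W (unit_slice W (g i) s)"
    by (intro unit_slice_proper_face[OF W g]) auto
  then have "unit_slice W (g i) s = F" using F i(3) by (simp add: facet_of_ball_def)
  with i show ?thesis by blast
qed

lemma card_facets_le: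
  fixes W :: "'a::real_normed_vector set"
  assumes W: "subspace W" and g: "norming_family W I g"
  shows "card {F. facet_of_ball W F} \<le> 2 * card I"
proof -
  have fin: "finite (I \<times> {-1, 1 :: real})" using g by (simp add: norming_family_def)
  have "{F. facet_of_ball W F} \<subseteq> (\<lambda>(i, s). unit_slice W (g i) s) ` (I \<times> {-1, 1})"
    using facet_is_unit_slice[OF W g] by fastforce
  then have "card {F. facet_of_ball W F} \<le> card (I \<times> {-1, 1 :: real})"
    by (rule surj_card_le[OF fin])
  then show ?thesis by (simp add: card_cartesian_product)
qed

text \<open>Normalising a vector at which \<open>g i\<close> strictly dominates gives a point of the slice \<open>g i = s\<close>
  that lies in no other slice. So no two slices are nested, and by
  \<open>proper_face_in_unit_slice\<close> every slice is maximal.\<close>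

lemma facets_irredundant:
  fixes W :: "'a::real_normed_vector set"
  assumes W: "subspace W" and g: "norming_family W I g"
    and dom: "\<And>i. i \<in> I \<Longrightarrow> \<exists>x\<in>W. g i x \<noteq> 0 \<and> (\<forall>j\<in>I. j \<noteq> i \<longrightarrow> \<bar>g j x\<bar> < \<bar>g i x\<bar>)"
  shows "finite {F. facet_of_ball W F}" and "card {F. facet_of_ball W F} = 2 * card I"
proof -
  let ?S = "\<lambda>t. unit_slice W (g (fst t)) (snd t)"
  let ?A = "I \<times> {-1, 1 :: real}"
  have finI: "finite I" and lin: "\<And>i. i \<in> I \<Longrightarrow> linear_on_subspace W (g i)"
    using g by (simp_all add: norming_family_def)
  have peak: "\<exists>x \<in> ?S t. \<forall>t'\<in>?A. t' \<noteq> t \<longrightarrow> x \<notin> ?S t'" if t: "t \<in> ?A" for t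
  proof -
    obtain i s where is_: "t = (i, s)" "i \<in> I" "s \<in> {-1, 1}" using t by auto
    obtain x where x: "x \<in> W" "g i x \<noteq> 0" "\<And>j. j \<in> I \<Longrightarrow> j \<noteq> i \<Longrightarrow> \<bar>g j x\<bar> < \<bar>g i x\<bar>"
      using dom[OF is_(2)] by blast
    define z where "z = (s / g i x) *\<^sub>R x"
    have zW: "z \<in> W" using W x by (simp add: z_def subspace_scale)
    have gz: "g j z = s / g i x * g j x" if "j \<in> I" for j
      using linear_on_subspace_scale[OF lin[OF that] x(1)] by (simp add: z_def)
    have gi: "g i z = s" using gz[OF is_(2)] x by simp
    have gj: "\<bar>g j z\<bar> < 1" if "j \<in> I" "j \<noteq> i" for j
    proof -
      have "\<bar>g j z\<bar> = \<bar>g j x\<bar> / \<bar>g i x\<bar>"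
        using gz[OF that(1)] is_(3) by (auto simp: abs_mult)
      then show ?thesis using x(3)[OF that] x(2) by simp
    qed
    obtain k where k: "k \<in> I" "\<bar>g k z\<bar> = norm z" using g zW by (auto simp: norming_family_def)
    have "norm z \<le> 1" using gi gj[OF k(1)] k is_(3) by (cases "k = i") auto
    then have "z \<in> ?S t" using zW gi is_ by (simp add: unit_slice_def unit_ball_of_def)
    moreover have "z \<notin> ?S t'" if "t' \<in> ?A" "t' \<noteq> t" for t'
    proof (cases "fst t' = i")
      case True
      then show ?thesis using that is_ gi by (auto simp: unit_slice_def)
    next
      case False
      then have "\<bar>g (fst t') z\<bar> < 1" using gj that by auto
      then show ?thesis using that by (auto simp: unit_slice_def)
    qed
    ultimately show ?thesis by blast
  qed
  have nested: "t = t'" if t: "t \<in> ?A" "t' \<in> ?A" "?S t \<subseteq> ?S t'" for t t'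
  proof -
    obtain x where "x \<in> ?S t" "\<And>t'. t' \<in> ?A \<Longrightarrow> t' \<noteq> t \<Longrightarrow> x \<notin> ?S t'"
      using peak[OF t(1)] by blast
    with t(2,3) show ?thesis by (metis subsetD)
  qed
  have inj: "inj_on ?S ?A" by (rule inj_onI) (use nested in blast)
  have "facet_of_ball W (?S t)" if t: "t \<in> ?A" for t
    unfolding facet_of_ball_def
  proof (intro conjI allI impI)
    show "proper_face_of_ball W (?S t)"
      using t peak[OF t] by (intro unit_slice_proper_face[OF W g]) auto
    fix G assume G: "proper_face_of_ball W G \<and> ?S t \<subseteq> G"
    then obtain i s where i: "i \<in> I" "s \<in> {-1, 1}" "G \<subseteq> unit_slice W (g i) s"
      using proper_face_in_unit_slice[OF W g, of G] by blast
    then have "t = (i, s)" using G t by (intro nested) auto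
    with G i show "G = ?S t" by auto
  qed
  moreover have "F \<in> ?S ` ?A" if "facet_of_ball W F" for F
    using facet_is_unit_slice[OF W g that] by force
  ultimately have eq: "{F. facet_of_ball W F} = ?S ` ?A" by blast
  show "finite {F. facet_of_ball W F}" unfolding eq using finI by simp
  show "card {F. facet_of_ball W F} = 2 * card I"
    unfolding eq card_image[OF inj] by (simp add: card_cartesian_product)
qed

section \<open>Norming families and embeddings into the maximum norm\<close>

lemma infnorm_attained: "\<exists>j. \<bar>x $ j\<bar> = infnorm (x :: real^'n)"
proof -
  have "infnorm x \<in> (\<lambda>b. \<bar>x \<bullet> b\<bar>) ` Basis"
    unfolding infnorm_Max by (rule Max_in) auto
  then show ?thesis by (auto simp: Basis_vec_def inner_axis)
qed

lemma norming_family_coordinates: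
  fixes T :: "'a::real_normed_vector \<Rightarrow> real^'n"
  assumes "isometric_embedding_linf W T"
  shows "norming_family W UNIV (\<lambda>j x. T x $ j)"
proof -
  have norm: "norm x = infnorm (T x)" if "x \<in> W" for x
    using assms that by (simp add: isometric_embedding_linf_def)
  have "linear_on_subspace W (\<lambda>x. T x $ j)" for j
    using assms by (simp add: isometric_embedding_linf_def linear_on_subspace_def)
  then show ?thesis
    using component_le_infnorm_cart[of "T _"] infnorm_attained[of "T _"]
    by (simp add: norming_family_def norm)
qed

text \<open>Surplus coordinates repeat members of the family, which does not change the maximum.\<close>

lemma norming_family_imp_embedding:
  fixes W :: "'a::real_normed_vector set"
  assumes g: "norming_family W I g" and ne: "I \<noteq> {}" and card: "card I \<le> CARD('n)"
  shows "\<exists>T :: 'a \<Rightarrow> real^'n. isometric_embedding_linf W T"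
proof -
  have finI: "finite I" using g by (simp add: norming_family_def)
  obtain e :: "_ \<Rightarrow> 'n" where e: "inj_on e I" using card_le_inj[OF finI finite card] by blast
  obtain i0 where i0: "i0 \<in> I" using ne by blast
  define h where "h j = (if j \<in> e ` I then inv_into I e j else i0)" for j
  have hI: "h j \<in> I" for j using i0 by (simp add: h_def inv_into_into)
  have he: "h (e i) = i" if "i \<in> I" for i using that e by (simp add: h_def)
  define T :: "'a \<Rightarrow> real^'n" where "T x = (\<chi> j. g (h j) x)" for x
  have "linear_on_subspace W T"
    using g hI unfolding norming_family_def linear_on_subspace_def T_def
    by (auto simp: vec_eq_iff)
  moreover have "infnorm (T x) = norm x" if x: "x \<in> W" for x
  proof (rule antisym)
    obtain j where j: "\<bar>T x $ j\<bar> = infnorm (T x)" using infnorm_attained by blast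
    have "\<bar>T x $ j\<bar> \<le> norm x"
      using g x hI[of j] by (simp add: norming_family_def T_def)
    then show "infnorm (T x) \<le> norm x" unfolding j .
    obtain i where i: "i \<in> I" "\<bar>g i x\<bar> = norm x" using g x by (auto simp: norming_family_def)
    then show "norm x \<le> infnorm (T x)"
      using component_le_infnorm_cart[of "T x" "e i"] he by (simp add: T_def)
  qed
  ultimately show ?thesis unfolding isometric_embedding_linf_def by blast
qed

section \<open>The norm of a combination of bounded sequences\<close>

definition basis_comb :: "('m::finite \<Rightarrow> linf) \<Rightarrow> real^'m \<Rightarrow> linf" where
  "basis_comb a \<beta> = (\<Sum>k\<in>UNIV. \<beta> $ k *\<^sub>R a k)"

lemma linear_basis_comb: "linear (basis_comb a)"
  by (rule linearI) (simp_all add: basis_comb_def scaleR_add_left sum.distrib scaleR_sum_right)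

lemma apply_basis_comb:
  "apply_bcontfun (basis_comb a \<beta>) i = \<beta> \<bullet> (\<chi> k. apply_bcontfun (a k) i)"
proof -
  have "apply_bcontfun (\<Sum>k\<in>A. \<beta> $ k *\<^sub>R a k) i = (\<Sum>k\<in>A. \<beta> $ k * apply_bcontfun (a k) i)"
    if "finite A" for A
    using that by (induction A rule: finite_induct) simp_all
  then show ?thesis by (simp add: basis_comb_def inner_vec_def)
qed

lemma compact_component_set: "compact (component_set a)"
proof -
  have "norm (\<chi> k. apply_bcontfun (a k) i) \<le> (\<Sum>k\<in>UNIV. norm (a k))" for i
    using norm_le_l1_cart[of "\<chi> k. apply_bcontfun (a k) i"]
    by (rule order_trans) (auto intro!: sum_mono simp: norm_bounded simp flip: real_norm_def)
  then have "bounded (range (\<lambda>i. \<chi> k. apply_bcontfun (a k) i))"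
    by (auto simp: bounded_iff)
  then show ?thesis by (simp add: component_set_def compact_closure)
qed

lemma inner_component_le_norm:
  assumes "q \<in> component_set a"
  shows "\<bar>\<beta> \<bullet> q\<bar> \<le> norm (basis_comb a \<beta>)"
proof -
  have "closed {q. \<bar>\<beta> \<bullet> q\<bar> \<le> norm (basis_comb a \<beta>)}"
    by (intro closed_Collect_le continuous_intros)
  moreover have "range (\<lambda>i. \<chi> k. apply_bcontfun (a k) i) \<subseteq> {q. \<bar>\<beta> \<bullet> q\<bar> \<le> norm (basis_comb a \<beta>)}"
    using norm_bounded[of "basis_comb a \<beta>"] by (auto simp: apply_basis_comb)
  ultimately have "component_set a \<subseteq> {q. \<bar>\<beta> \<bullet> q\<bar> \<le> norm (basis_comb a \<beta>)}"
    unfolding component_set_def by (rule closure_minimal[rotated])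
  then show ?thesis using assms by blast
qed

lemma norm_attained_at_component:
  "\<exists>q\<in>component_set a. \<bar>\<beta> \<bullet> q\<bar> = norm (basis_comb a \<beta>)"
proof -
  have row: "(\<chi> k. apply_bcontfun (a k) i) \<in> component_set a" for i
    unfolding component_set_def by (rule subsetD[OF closure_subset]) auto
  have "continuous_on (component_set a) (\<lambda>q. \<bar>\<beta> \<bullet> q\<bar>)" by (intro continuous_intros)
  moreover have "component_set a \<noteq> {}" using row by blast
  ultimately obtain q where q: "q \<in> component_set a"
    "\<And>p. p \<in> component_set a \<Longrightarrow> \<bar>\<beta> \<bullet> p\<bar> \<le> \<bar>\<beta> \<bullet> q\<bar>"
    using continuous_attains_sup[OF compact_component_set, of a "\<lambda>q. \<bar>\<beta> \<bullet> q\<bar>"] by metis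
  have "norm (basis_comb a \<beta>) \<le> \<bar>\<beta> \<bullet> q\<bar>"
    using q(2)[OF row] by (intro norm_bound) (simp add: apply_basis_comb)
  with inner_component_le_norm[OF q(1)] q(1) show ?thesis by (metis antisym)
qed

section \<open>Representatives of the weak star components\<close>

lemma equiv_components_inner:
  "q \<in> equiv_components a p \<Longrightarrow> \<bar>\<beta> \<bullet> q\<bar> = \<bar>\<beta> \<bullet> p\<bar>"
  by (auto simp: equiv_components_def)

lemma weak_star_property_if_attains_norm:
  assumes p: "p \<in> component_set a" and \<beta>: "\<beta> \<noteq> 0" and att: "\<bar>\<beta> \<bullet> p\<bar> = norm (basis_comb a \<beta>)"
  shows "weak_star_property a p"
proof -
  have "(SUP q \<in> component_set a - equiv_components a p. \<bar>\<beta> \<bullet> q\<bar>) \<le> \<bar>\<beta> \<bullet> p\<bar>"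
    if "component_set a - equiv_components a p \<noteq> {}"
    using that inner_component_le_norm[of _ a \<beta>] att by (intro cSUP_least) auto
  then show ?thesis using p \<beta>
    unfolding weak_star_property_def by (auto simp: inner_vec_def intro!: exI[of _ \<beta>])
qed

text \<open>The zero vector can witness the star property only if there are no inequivalent components;
  then any nonzero vector serves instead. The norm of the combination is attained at some component,
  which strict dominance forces to be \<open>\<plusminus>p\<close>.\<close>

lemma star_property_witness:
  fixes a :: "'m::finite \<Rightarrow> linf"
  assumes "star_property a p"
  shows "\<exists>\<beta>. \<beta> \<noteq> 0 \<and> \<bar>\<beta> \<bullet> p\<bar> = norm (basis_comb a \<beta>) \<and>
    (\<forall>q \<in> component_set a - equiv_components a p. \<bar>\<beta> \<bullet> q\<bar> < \<bar>\<beta> \<bullet> p\<bar>)"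
proof -
  obtain \<beta> :: "real^'m" where p: "p \<in> component_set a"
    and \<beta>: "\<forall>q \<in> component_set a - equiv_components a p. \<bar>\<beta> \<bullet> q\<bar> < \<bar>\<beta> \<bullet> p\<bar>"
    using assms by (auto simp: star_property_def inner_vec_def)
  have "\<exists>\<gamma>::real^'m. \<gamma> \<noteq> 0 \<and>
    (\<forall>q \<in> component_set a - equiv_components a p. \<bar>\<gamma> \<bullet> q\<bar> < \<bar>\<gamma> \<bullet> p\<bar>)"
  proof (cases "\<beta> = 0")
    case True
    with \<beta> show ?thesis by (intro exI[of _ 1]) auto
  next
    case False
    with \<beta> show ?thesis by blast
  qed
  then obtain \<gamma> :: "real^'m" where \<gamma>: "\<gamma> \<noteq> 0"
    "\<forall>q \<in> component_set a - equiv_components a p. \<bar>\<gamma> \<bullet> q\<bar> < \<bar>\<gamma> \<bullet> p\<bar>" by blast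
  obtain q where q: "q \<in> component_set a" "\<bar>\<gamma> \<bullet> q\<bar> = norm (basis_comb a \<gamma>)"
    using norm_attained_at_component by blast
  have "\<not> \<bar>\<gamma> \<bullet> q\<bar> < \<bar>\<gamma> \<bullet> p\<bar>" using q(2) inner_component_le_norm[OF p, of \<gamma>] by simp
  then have "q \<in> equiv_components a p" using \<gamma>(2) q(1) by blast
  then have "\<bar>\<gamma> \<bullet> p\<bar> = norm (basis_comb a \<gamma>)" using q equiv_components_inner by metis
  with \<gamma> show ?thesis by blast
qed

lemma star_imp_weak_star:
  assumes "star_property a p"
  shows "weak_star_property a p"
proof -
  obtain \<beta> where "\<beta> \<noteq> 0" "\<bar>\<beta> \<bullet> p\<bar> = norm (basis_comb a \<beta>)"
    using star_property_witness[OF assms] by blast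
  moreover have "p \<in> component_set a" using assms by (simp add: star_property_def)
  ultimately show ?thesis by (intro weak_star_property_if_attains_norm)
qed

text \<open>Each member of \<open>Q\<close> is equivalent to a unique member of \<open>P\<close>, and inequivalent members go to
  different ones; as the sets have the same finite size, every member of \<open>P\<close> is reached.\<close>

lemma weak_star_representative_is_star:
  fixes a :: "'m::finite \<Rightarrow> linf"
  assumes P: "nonequiv_representatives a (weak_star_property a) P"
    and Q: "nonequiv_representatives a (star_property a) Q"
    and fin: "finite P" and card: "card P = card Q" and p: "p \<in> P"
  shows "star_property a p"
proof -
  have "\<forall>q\<in>Q. \<exists>p. p \<in> P \<and> p \<in> equiv_components a q"
    using P Q star_imp_weak_star unfolding nonequiv_representatives_def by blast
  then obtain f where f: "\<And>q. q \<in> Q \<Longrightarrow> f q \<in> P \<and> f q \<in> equiv_components a q" by metis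
  have QK: "q \<in> component_set a" "star_property a q" if "q \<in> Q" for q
    using Q that by (auto simp: nonequiv_representatives_def)
  have "inj_on f Q"
  proof (rule inj_onI)
    fix q q' assume q: "q \<in> Q" "q' \<in> Q" "f q = f q'"
    then have "q' \<in> equiv_components a q" "q \<in> equiv_components a q"
      using f[of q] f[of q'] QK by (auto simp: equiv_components_def)
    with q QK[of q] Q show "q = q'" unfolding nonequiv_representatives_def by blast
  qed
  then have "card (f ` Q) = card P" using card by (simp add: card_image)
  moreover have "f ` Q \<subseteq> P" using f by blast
  ultimately have "f ` Q = P" using fin by (simp add: card_subset_eq)
  then obtain q where q: "q \<in> Q" "p = f q" using p by blast
  with f[of q] have pq: "p = q \<or> p = - q" "p \<in> component_set a"
    by (auto simp: equiv_components_def)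
  then have "equiv_components a p = equiv_components a q"
    by (auto simp: equiv_components_def)
  moreover have "\<bar>\<Sum>k\<in>UNIV. \<beta> $ k * p $ k\<bar> = \<bar>\<Sum>k\<in>UNIV. \<beta> $ k * q $ k\<bar>" for \<beta> :: "real^'m"
    using pq(1) by (auto simp: sum_negf)
  ultimately show ?thesis using QK(2)[OF q(1)] pq(2) by (simp add: star_property_def)
qed

lemma norm_attained_at_representative:
  fixes a :: "'m::finite \<Rightarrow> linf"
  assumes P: "nonequiv_representatives a (weak_star_property a) P"
  shows "\<exists>p\<in>P. \<bar>\<beta> \<bullet> p\<bar> = norm (basis_comb a \<beta>)"
proof -
  have ne: "\<exists>p\<in>P. \<bar>\<gamma> \<bullet> p\<bar> = norm (basis_comb a \<gamma>)" if "\<gamma> \<noteq> 0" for \<gamma>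
  proof -
    obtain q where q: "q \<in> component_set a" "\<bar>\<gamma> \<bullet> q\<bar> = norm (basis_comb a \<gamma>)"
      using norm_attained_at_component by blast
    with that have "weak_star_property a q" by (intro weak_star_property_if_attains_norm)
    then obtain p where "p \<in> P" "p \<in> equiv_components a q"
      using P q unfolding nonequiv_representatives_def by blast
    with q show ?thesis using equiv_components_inner by metis
  qed
  show ?thesis
  proof (cases "\<beta> = 0")
    case True
    have "P \<noteq> {}" using ne[of 1] by auto
    then show ?thesis using True by (auto simp: basis_comb_def)
  qed (rule ne)
qed

section \<open>Coordinates on the subspace\<close>

lemma bij_basis_comb:
  fixes a :: "'m::finite \<Rightarrow> linf"
  assumes a: "inj a" "independent (range a)" and W: "span (range a) = W"
  shows "bij_betw (basis_comb a) UNIV W"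
  unfolding bij_betw_def
proof
  have re: "(\<Sum>v\<in>range a. u v *\<^sub>R v) = basis_comb a (\<chi> k. u (a k))" for u
    using a(1) by (simp add: basis_comb_def sum.reindex)
  show "inj (basis_comb a)"
  proof (rule linear_injective_0[OF linear_basis_comb, THEN iffD2], intro allI impI)
    fix \<beta> assume 0: "basis_comb a \<beta> = 0"
    have "(\<Sum>v\<in>range a. \<beta> $ inv a v *\<^sub>R v) = 0" using 0 a(1) by (simp add: re)
    then have "\<beta> $ inv a (a k) = 0" for k
      using a(2) by (intro independentD[where t = "range a"]) auto
    then show "\<beta> = 0" using a(1) by (simp add: vec_eq_iff)
  qed
  have "basis_comb a \<beta> \<in> W" for \<beta>
    unfolding basis_comb_def W[symmetric] by (intro span_sum span_scale span_base) auto
  moreover have "x \<in> range (basis_comb a)" if "x \<in> W" for x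
  proof -
    have "x \<in> range (\<lambda>u. \<Sum>v\<in>range a. u v *\<^sub>R v)"
      using that by (simp add: W[symmetric] span_finite)
    then show ?thesis by (auto simp: re)
  qed
  ultimately show "range (basis_comb a) = W" by blast
qed

definition component_functional :: "('m::finite \<Rightarrow> linf) \<Rightarrow> real^'m \<Rightarrow> linf \<Rightarrow> real" where
  "component_functional a p x = inv (basis_comb a) x \<bullet> p"

lemma component_functional_comb:
  "inj (basis_comb a) \<Longrightarrow> component_functional a p (basis_comb a \<beta>) = \<beta> \<bullet> p"
  by (simp add: component_functional_def)

lemma linear_on_component_functional:
  assumes bij: "bij_betw (basis_comb a) UNIV W"
  shows "linear_on_subspace W (component_functional a p)"
proof -
  have inj: "inj (basis_comb a)" and ran: "range (basis_comb a) = W"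
    using bij by (auto simp: bij_betw_def)
  show ?thesis
    unfolding linear_on_subspace_def ran[symmetric] ball_simps
    by (simp add: linear_add[OF linear_basis_comb, symmetric]
        linear_scale[OF linear_basis_comb, symmetric] component_functional_comb[OF inj]
        inner_add_left)
qed

lemma norming_family_representatives:
  assumes bij: "bij_betw (basis_comb a) UNIV W"
    and P: "nonequiv_representatives a (weak_star_property a) P" and fin: "finite P"
  shows "norming_family W P (component_functional a)"
proof -
  have inj: "inj (basis_comb a)" and ran: "range (basis_comb a) = W"
    using bij by (auto simp: bij_betw_def)
  have "P \<subseteq> component_set a" using P by (auto simp: nonequiv_representatives_def)
  then have "\<forall>p\<in>P. \<bar>\<beta> \<bullet> p\<bar> \<le> norm (basis_comb a \<beta>)" for \<beta>
    using inner_component_le_norm by blast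
  then have "\<forall>x\<in>range (basis_comb a). (\<forall>p\<in>P. \<bar>component_functional a p x\<bar> \<le> norm x) \<and>
      (\<exists>p\<in>P. \<bar>component_functional a p x\<bar> = norm x)"
    using norm_attained_at_representative[OF P]
    by (simp add: component_functional_comb[OF inj])
  then show ?thesis
    using fin linear_on_component_functional[OF bij] by (simp add: norming_family_def ran)
qed

lemma representatives_irredundant:
  assumes bij: "bij_betw (basis_comb a) UNIV W"
    and P: "nonequiv_representatives a (weak_star_property a) P"
    and p: "p \<in> P" and star: "star_property a p"
  shows "\<exists>x\<in>W. component_functional a p x \<noteq> 0 \<and>
    (\<forall>q\<in>P. q \<noteq> p \<longrightarrow> \<bar>component_functional a q x\<bar> < \<bar>component_functional a p x\<bar>)"
proof -
  have inj: "inj (basis_comb a)" and ran: "range (basis_comb a) = W"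
    using bij by (auto simp: bij_betw_def)
  obtain \<beta> where \<beta>: "\<beta> \<noteq> 0" "\<bar>\<beta> \<bullet> p\<bar> = norm (basis_comb a \<beta>)"
    "\<And>q. q \<in> component_set a - equiv_components a p \<Longrightarrow> \<bar>\<beta> \<bullet> q\<bar> < \<bar>\<beta> \<bullet> p\<bar>"
    using star_property_witness[OF star] by blast
  have PK: "q \<in> component_set a" "weak_star_property a q" if "q \<in> P" for q
    using P that by (auto simp: nonequiv_representatives_def)
  have "\<bar>\<beta> \<bullet> q\<bar> < \<bar>\<beta> \<bullet> p\<bar>" if q: "q \<in> P" "q \<noteq> p" for q
  proof (rule \<beta>(3))
    have "p \<in> equiv_components a p" using PK[OF p] by (simp add: equiv_components_def)
    then have "q \<notin> equiv_components a p"
      using P PK[OF p] p q unfolding nonequiv_representatives_def by blast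
    then show "q \<in> component_set a - equiv_components a p" using PK[OF q(1)] by blast
  qed
  moreover have "basis_comb a \<beta> \<noteq> 0"
    using \<beta>(1) inj linear_injective_0[OF linear_basis_comb] by blast
  then have "\<beta> \<bullet> p \<noteq> 0" using \<beta>(2) by auto
  ultimately show ?thesis
    using ran by (intro bexI[of _ "basis_comb a \<beta>"]) (auto simp: component_functional_comb[OF inj])
qed

text \<open>With fewer representatives than the dimension, a nonzero vector would be orthogonal to all of
  them and so have norm zero.\<close>

lemma card_representatives_ge:
  fixes a :: "'m::finite \<Rightarrow> linf"
  assumes inj: "inj (basis_comb a)"
    and P: "nonequiv_representatives a (weak_star_property a) P" and fin: "finite P"
  shows "CARD('m) \<le> card P"
proof (rule ccontr)
  assume "\<not> ?thesis"
  then have "dim (span P) < DIM(real^'m)" using dim_le_card'[OF fin] by simp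
  then obtain x where x: "x \<noteq> 0" "\<And>y. y \<in> span P \<Longrightarrow> orthogonal x y"
    using orthogonal_to_subspace_exists by (metis dim_span)
  obtain p where p: "p \<in> P" "\<bar>x \<bullet> p\<bar> = norm (basis_comb a x)"
    using norm_attained_at_representative[OF P] by blast
  then have "basis_comb a x = 0" using x(2)[OF span_base[OF p(1)]] by (simp add: orthogonal_def)
  then show False using x(1) inj linear_injective_0[OF linear_basis_comb] by blast
qed

lemma isometric_embedding_bij:
  fixes T :: "linf \<Rightarrow> real^'m" and a :: "'m::finite \<Rightarrow> linf"
  assumes bij: "bij_betw (basis_comb a) UNIV W" and T: "isometric_embedding_linf W T"
  shows "bij_betw T W UNIV"
proof -
  have inj: "inj (basis_comb a)" and ran: "range (basis_comb a) = W"
    using bij by (auto simp: bij_betw_def)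
  have mem: "basis_comb a \<beta> \<in> W" for \<beta> using ran by blast
  have lin: "linear (T \<circ> basis_comb a)"
    using T mem by (intro linearI) (auto simp: isometric_embedding_linf_def linear_on_subspace_def
        linear_add[OF linear_basis_comb] linear_scale[OF linear_basis_comb])
  have "\<beta> = 0" if "T (basis_comb a \<beta>) = 0" for \<beta>
  proof -
    have "norm (basis_comb a \<beta>) = infnorm (T (basis_comb a \<beta>))"
      using T mem by (simp add: isometric_embedding_linf_def)
    then have "basis_comb a \<beta> = 0" using that by (simp add: infnorm_0)
    then show ?thesis using inj linear_injective_0[OF linear_basis_comb] by blast
  qed
  then have "inj (T \<circ> basis_comb a)" using linear_injective_0[OF lin] by auto
  moreover from this have "surj (T \<circ> basis_comb a)"
    using linear_injective_imp_surjective[OF lin] by simp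
  ultimately have "bij_betw (T \<circ> basis_comb a) UNIV UNIV" by (simp add: bij_betw_def)
  then show ?thesis using bij_betw_comp_iff[OF bij] by blast
qed

section \<open>Facets and embeddings in terms of components\<close>

theorem theorem2p6:
  fixes W :: "linf set" and a :: "'m::finite \<Rightarrow> linf"
    and P Q :: "(real^'m) set" and r :: nat
  assumes "subspace W" and "dim W = CARD('m)"
    and "inj a" and "independent (range a)" and "span (range a) = W"
    and "nonequiv_representatives a (weak_star_property a) P"
    and "nonequiv_representatives a (star_property a) Q"
    and "finite P" and "card P = r"
    and "finite Q" and "card Q = r"
  shows "(finite {F. facet_of_ball W F} \<and> card {F. facet_of_ball W F} = 2 * r) \<and>
    ((\<exists>T :: linf \<Rightarrow> real^'n::finite. isometric_embedding_linf W T) \<longleftrightarrow> r \<le> CARD('n)) \<and>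
    ((\<exists>T :: linf \<Rightarrow> real^'m. isometric_isomorphism_linf W T) \<longleftrightarrow> r = CARD('m))"
proof -
  note W = assms(1) and P = assms(6)
  have bij: "bij_betw (basis_comb a) UNIV W" by (rule bij_basis_comb[OF assms(3-5)])
  have norming: "norming_family W P (component_functional a)"
    by (rule norming_family_representatives[OF bij P assms(8)])
  have star: "star_property a p" if "p \<in> P" for p
    using weak_star_representative_is_star[OF P assms(7,8) _ that] assms(9,11) by simp
  note facets = facets_irredundant[OF W norming representatives_irredundant[OF bij P _ star],
      unfolded assms(9)]
  have ge: "CARD('m) \<le> r"
    using card_representatives_ge[OF _ P assms(8)] bij assms(9) by (simp add: bij_betw_def)
  then have ne: "P \<noteq> {}" using assms(9) by auto
  have le: "r \<le> CARD('k)" if "isometric_embedding_linf W T" for T :: "linf \<Rightarrow> real^'k::finite"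
    using card_facets_le[OF W norming_family_coordinates[OF that]] facets(2) by simp
  have emb_n: "\<exists>T :: linf \<Rightarrow> real^'n. isometric_embedding_linf W T" if "r \<le> CARD('n)"
    using norming_family_imp_embedding[OF norming ne] that assms(9) by simp
  have emb_m: "\<exists>T :: linf \<Rightarrow> real^'m. isometric_embedding_linf W T" if "r \<le> CARD('m)"
    using norming_family_imp_embedding[OF norming ne] that assms(9) by simp
  have "(\<exists>T :: linf \<Rightarrow> real^'m. isometric_isomorphism_linf W T) \<longleftrightarrow> r = CARD('m)"
    using ge le emb_m isometric_embedding_bij[OF bij]
    unfolding isometric_isomorphism_linf_def by (metis antisym order_refl)
  with facets le emb_n show ?thesis by blast
qed

end
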